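(* Let $R$ be a commutative ring with unity that has at least one nontrivial idempotent (an idempotent different from $0$ and $1$). Then: (i) If $|U(R)|=1$, then $\mathrm{Cl}_2(R)$ is a complete graph. (ii) If $|U(R)|\ge 2$, then two distinct vertices $(e,u)$ and $(f,v)$ of $\mathrm{Cl}_2(R)$ are mutually maximally distant in $\mathrm{Cl}_2(R)$ if and only if one of the following holds: (a) $e=f=1$ and $uv\neq 1$; (b) $e\neq 1$, $f\neq 1$, $ef\neq 0$ and $uv\neq 1$; (c) exactly one of $e,f$ equals $1$ and $u=v\in U''(R)$.
   Context: All rings are commutative with unity. $U(R)$ is the set of units, $\mathrm{Id}(R)$ the set of idempotents, $U'(R)=\{u\in U(R): u^2=1\}$ and $U''(R)=U(R)\setminus U'(R)$. The clean graph $\mathrm{Cl}(R)$ is the simple undirected graph with vertex set $\{(e,u): e\in \mathrm{Id}(R),\ u\in U(R)\}$ in which two distinct vertices $(e,u),(f,v)$ are adjacent iff $ef=0$ or $uv=1$. $\mathrm{Cl}_2(R)$ is the subgraph of $\mathrm{Cl}(R)$ induced by the vertices $(e,u)$ with $e\neq 0$. Distances $d$ are taken in $\mathrm{Cl}_2(R)$, $N(x)$ denotes the neighbourhood of $x$. A vertex $x$ is maximally distant from $y$ if $d(y,w)\le d(x,y)$ for every $w\in N(x)$; $x,y$ are mutually maximally distant if each is maximally distant from the other. *)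

theory Defs
  imports "HOL-Algebra.Ring" "Graph_Theory.Digraph_Component" "Graph_Theory.Shortest_Path"
begin

definition idempotents :: "('a, 'm) ring_scheme \<Rightarrow> 'a set" where
  "idempotents R = {e \<in> carrier R. e \<otimes>\<^bsub>R\<^esub> e = e}"

definition Units_invol :: "('a, 'm) ring_scheme \<Rightarrow> 'a set" where
  "Units_invol R = {u \<in> Units R. u \<otimes>\<^bsub>R\<^esub> u = \<one>\<^bsub>R\<^esub>}"

definition Units_noninvol :: "('a, 'm) ring_scheme \<Rightarrow> 'a set" where
  "Units_noninvol R = Units R - Units_invol R"

text \<open>A simple undirected graph is represented as a symmetric loop-free digraph without
  parallel arcs, an edge being a pair of opposite arcs. Finiteness is not required, as the
  ring may be infinite.\<close>

definition clean_graph :: "('a, 'm) ring_scheme \<Rightarrow> ('a \<times> 'a) pair_pre_digraph" where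
  "clean_graph R =
    \<lparr> pverts = idempotents R \<times> Units R,
      parcs = {((e, u), (f, v)) | e u f v.
        (e, u) \<in> idempotents R \<times> Units R \<and> (f, v) \<in> idempotents R \<times> Units R \<and> (e, u) \<noteq> (f, v) \<and>
        (e \<otimes>\<^bsub>R\<^esub> f = \<zero>\<^bsub>R\<^esub> \<or> u \<otimes>\<^bsub>R\<^esub> v = \<one>\<^bsub>R\<^esub>)} \<rparr>"

definition clean_graph2 ::
  "('a, 'm) ring_scheme \<Rightarrow> ('a \<times> 'a, ('a \<times> 'a) \<times> ('a \<times> 'a)) pre_digraph" where
  "clean_graph2 R =
    with_proj (clean_graph R) \<restriction> {(e, u) \<in> pverts (clean_graph R). e \<noteq> \<zero>\<^bsub>R\<^esub>}"

lemma clean_graph_bidirected: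
  assumes "cring R"
  shows "pair_bidirected_digraph (clean_graph R)"
proof -
  interpret cring R by fact
  have "symmetric (with_proj (clean_graph R))"
    unfolding symmetric_def
    by (rule symI) (auto simp: clean_graph_def idempotents_def m_comm Units_closed)
  then show ?thesis
    by unfold_locales (auto simp: clean_graph_def)
qed

lemma clean_graph2_simple:
  assumes "cring R"
  shows "loopfree_digraph (clean_graph2 R)" "nomulti_digraph (clean_graph2 R)"
    "sym_digraph (clean_graph2 R)"
proof -
  interpret cring R by fact
  have wf: "wf_digraph (clean_graph2 R)"
    by unfold_locales (auto simp: clean_graph2_def)
  show "loopfree_digraph (clean_graph2 R)"
    using wf by (auto simp: loopfree_digraph_def loopfree_digraph_axioms_def
        clean_graph2_def clean_graph_def)
  show "nomulti_digraph (clean_graph2 R)"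
    using wf by (auto simp: nomulti_digraph_def nomulti_digraph_axioms_def
        clean_graph2_def arc_to_ends_def)
  have "symmetric (clean_graph2 R)"
    unfolding symmetric_def
    by (rule symI)
      (auto simp: clean_graph2_def clean_graph_def arcs_ends_conv idempotents_def m_comm Units_closed
        image_iff)
  with wf show "sym_digraph (clean_graph2 R)"
    by (simp add: sym_digraph_def sym_digraph_axioms_def)
qed

definition complete_graph :: "('v, 'e) pre_digraph \<Rightarrow> bool" where
  "complete_graph G \<longleftrightarrow>
    arcs_ends G = {(x, y). x \<in> verts G \<and> y \<in> verts G \<and> x \<noteq> y}"

definition neighbourhood :: "('v, 'e) pre_digraph \<Rightarrow> 'v \<Rightarrow> 'v set" where
  "neighbourhood G x = {w. (x, w) \<in> arcs_ends G}"

text \<open>With unit weights the cost of a walk is its length, so this is the usual graph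
  distance, infinite between different components.\<close>

definition graph_dist :: "('v, 'e) pre_digraph \<Rightarrow> 'v \<Rightarrow> 'v \<Rightarrow> ereal" where
  "graph_dist G x y = wf_digraph.\<mu> G (\<lambda>_. 1) x y"

definition maximally_distant :: "('v, 'e) pre_digraph \<Rightarrow> 'v \<Rightarrow> 'v \<Rightarrow> bool" where
  "maximally_distant G x y \<longleftrightarrow>
    (\<forall>w \<in> neighbourhood G x. graph_dist G y w \<le> graph_dist G x y)"

definition mutually_maximally_distant :: "('v, 'e) pre_digraph \<Rightarrow> 'v \<Rightarrow> 'v \<Rightarrow> bool" where
  "mutually_maximally_distant G x y \<longleftrightarrow> maximally_distant G x y \<and> maximally_distant G y x"

end

theory Submission
  imports Defs
begin

text \<open>
  The subgraph has diameter at most 3: non-adjacent vertices (e,u), (f,v) with e \<noteq> 1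
  have the common neighbour (1-e, v^-1), while (1,u) has only neighbours (g, u^-1), so that
  non-adjacent (1,u), (1,v) are at distance 3, joined through (g, u^-1) and (1-g, v^-1) for a
  nontrivial idempotent g. Hence a vertex is maximally distant from a non-adjacent one unless
  the latter is some (1,u), the distance is 2, and the former has a neighbour at distance 3
  from (1,u). Adjacent vertices are never mutually maximally distant, because one of the two has
  a neighbour that is neither equal nor adjacent to the other.
\<close>

section \<open>Distances in digraphs\<close>

context wf_digraph
begin

text \<open>The infimum of walk costs is attained at a shortest walk, whose unit-weight cost is its
  length; distances thus become questions of which walk lengths occur.\<close>

lemma graph_dist_eq_length:
  assumes "awalk x p y" "\<And>q. awalk x q y \<Longrightarrow> length p \<le> length q"
  shows "graph_dist G x y = ereal (real (length p))"
proof -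
  have cost: "awalk_cost (\<lambda>_. 1) q = real (length q)" for q :: "'b list"
    by (induct q) auto
  show ?thesis
    unfolding graph_dist_def \<mu>_def cost using assms by (intro INF_eqI) auto
qed

lemma awalk_length_0_iff: "(\<exists>p. awalk x p y \<and> length p = 0) \<longleftrightarrow> x = y \<and> x \<in> verts G"
  by (auto simp: awalk_Nil_iff)

text \<open>Peeling off the first arc turns the existence of a walk of given length into a condition
  on adjacency alone, which is what excludes short walks below.\<close>

lemma awalk_length_Suc_iff:
  "(\<exists>p. awalk x p y \<and> length p = Suc n) \<longleftrightarrow>
    (\<exists>z. (x, z) \<in> arcs_ends G \<and> (\<exists>p. awalk z p y \<and> length p = n))" (is "?L \<longleftrightarrow> ?R")
proof
  assume ?L
  then obtain a p where "a \<in> arcs G" "tail G a = x" "awalk (head G a) p y" "length p = n"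
    by (auto simp: length_Suc_conv awalk_Cons_iff)
  then show ?R
    unfolding arcs_ends_conv by (intro exI[of _ "head G a"]) auto
next
  assume ?R
  then obtain a p where "a \<in> arcs G" "tail G a = x" "awalk (head G a) p y" "length p = n"
    by (auto simp: arcs_ends_conv)
  then show ?L
    by (intro exI[of _ "a # p"]) (auto simp: awalk_Cons_iff)
qed

lemma awalk_length_1_iff: "(\<exists>p. awalk x p y \<and> length p = Suc 0) \<longleftrightarrow> (x, y) \<in> arcs_ends G"
  unfolding awalk_length_Suc_iff awalk_length_0_iff by (auto simp: arcs_ends_conv)

lemma graph_dist_self:
  assumes "x \<in> verts G"
  shows "graph_dist G x x = 0"
  using graph_dist_eq_length[of x "[]" x] assms by (simp add: awalk_Nil_iff zero_ereal_def)

lemma graph_dist_adj: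
  assumes "x \<noteq> y" "(x, y) \<in> arcs_ends G"
  shows "graph_dist G x y = 1"
proof -
  obtain p where p: "awalk x p y" "length p = 1"
    using assms(2) awalk_length_1_iff by auto
  have "length q \<noteq> 0" if "awalk x q y" for q
    using that assms(1) awalk_length_0_iff by blast
  then show ?thesis
    using graph_dist_eq_length[OF p(1)] p(2) by (simp add: one_ereal_def Suc_le_eq)
qed

lemma graph_dist_2:
  assumes "x \<noteq> y" "(x, y) \<notin> arcs_ends G" "(x, z) \<in> arcs_ends G" "(z, y) \<in> arcs_ends G"
  shows "graph_dist G x y = 2"
proof -
  obtain p where p: "awalk x p y" "length p = Suc (Suc 0)"
    using assms(3,4) awalk_length_1_iff awalk_length_Suc_iff by metis
  have "length p \<le> length q" if "awalk x q y" for q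
  proof -
    have "length q \<noteq> 0" "length q \<noteq> Suc 0"
      using that assms(1,2) awalk_length_0_iff[of x y] awalk_length_1_iff[of x y] by blast+
    then show ?thesis
      using p(2) by linarith
  qed
  then show ?thesis
    using graph_dist_eq_length[OF p(1)] p(2) by simp
qed

lemma graph_dist_3:
  assumes "x \<noteq> y" "(x, y) \<notin> arcs_ends G"
    and "\<And>z. (x, z) \<in> arcs_ends G \<Longrightarrow> (z, y) \<notin> arcs_ends G"
    and "(x, z) \<in> arcs_ends G" "(z, w) \<in> arcs_ends G" "(w, y) \<in> arcs_ends G"
  shows "graph_dist G x y = 3"
proof -
  obtain p where p: "awalk x p y" "length p = Suc (Suc (Suc 0))"
    using assms(4-6) awalk_length_1_iff awalk_length_Suc_iff by metis
  have "length p \<le> length q" if "awalk x q y" for q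
  proof -
    have "length q \<noteq> 0" "length q \<noteq> Suc 0"
      using that assms(1,2) awalk_length_0_iff[of x y] awalk_length_1_iff[of x y] by blast+
    \<comment> \<open>A walk of length 2 would pass through a common neighbour of \<open>x\<close>
      and \<open>y\<close>.\<close>
    moreover have "length q \<noteq> Suc (Suc 0)"
      using that assms(3) awalk_length_Suc_iff[of x y "Suc 0"] unfolding awalk_length_1_iff by blast
    ultimately show ?thesis
      using p(2) by linarith
  qed
  then show ?thesis
    using graph_dist_eq_length[OF p(1)] p(2) by simp
qed

end

section \<open>The clean graph\<close>

context cring
begin

section \<open>Complementary idempotents\<close>

lemma minus_eq_zero_iff:
  assumes "a \<in> carrier R" "b \<in> carrier R"
  shows "a \<ominus> b = \<zero> \<longleftrightarrow> a = b"
  using assms by (metis a_inv_closed minus_eq minus_equality minus_minus r_neg)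

text \<open>Orthogonality makes \<open>(\<one> \<ominus> e, t)\<close> a neighbour of
  \<open>(e, u)\<close> for every unit \<open>t\<close> when \<open>e\<close> is neither 0 nor 1, so
  complements supply neighbours whose unit is free.\<close>

lemma idempotents_compl:
  assumes "e \<in> idempotents R"
  shows "\<one> \<ominus> e \<in> idempotents R" "e \<otimes> (\<one> \<ominus> e) = \<zero>" "(\<one> \<ominus> e) \<otimes> e = \<zero>"
proof -
  have e: "e \<in> carrier R" "e \<otimes> e = e"
    using assms by (auto simp: idempotents_def)
  have "e \<otimes> (\<one> \<ominus> e) = e \<ominus> e \<otimes> e"
    using e(1) by algebra
  also have "\<dots> = \<zero>"
    using e by (simp add: minus_eq_zero_iff)
  finally show *: "e \<otimes> (\<one> \<ominus> e) = \<zero>" .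
  then show "(\<one> \<ominus> e) \<otimes> e = \<zero>"
    using e(1) by (simp add: m_comm)
  have "(\<one> \<ominus> e) \<otimes> (\<one> \<ominus> e) = (\<one> \<ominus> e) \<ominus> e \<otimes> (\<one> \<ominus> e)"
    using e(1) by algebra
  also have "\<dots> = \<one> \<ominus> e"
    using e(1) * by algebra
  finally show "\<one> \<ominus> e \<in> idempotents R"
    using e(1) by (simp add: idempotents_def)
qed

lemma idempotents_compl_eq_zero_iff:
  assumes "e \<in> idempotents R"
  shows "\<one> \<ominus> e = \<zero> \<longleftrightarrow> e = \<one>"
  using assms by (auto simp: idempotents_def minus_eq_zero_iff)

section \<open>Vertices and adjacency in Cl_2(R)\<close>

lemma verts_clean_graph2:
  "(e, u) \<in> verts (clean_graph2 R) \<longleftrightarrow> e \<in> idempotents R \<and> e \<noteq> \<zero> \<and> u \<in> Units R"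
  by (auto simp: clean_graph2_def clean_graph_def)

lemma arcs_ends_clean_graph2:
  "((e, u), (f, v)) \<in> arcs_ends (clean_graph2 R) \<longleftrightarrow>
    (e, u) \<in> verts (clean_graph2 R) \<and> (f, v) \<in> verts (clean_graph2 R) \<and> (e, u) \<noteq> (f, v) \<and>
    (e \<otimes> f = \<zero> \<or> u \<otimes> v = \<one>)"
proof -
  have "arcs_ends (clean_graph2 R) = arcs (clean_graph2 R)"
    by (simp add: arcs_ends_conv clean_graph2_def)
  then show ?thesis
    unfolding verts_clean_graph2 by (auto simp: clean_graph2_def clean_graph_def)
qed

lemma arcs_ends_clean_graph2_sym:
  "(x, y) \<in> arcs_ends (clean_graph2 R) \<Longrightarrow> (y, x) \<in> arcs_ends (clean_graph2 R)"
  by (cases x; cases y)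
    (auto simp: arcs_ends_clean_graph2 verts_clean_graph2 idempotents_def m_comm Units_closed)

section \<open>The distance formula\<close>

text \<open>A closed formula reduces the comparisons in \<open>maximally_distant\<close> to case
  distinctions on idempotents and units.\<close>

lemma clean_graph2_dist:
  assumes g: "g \<in> idempotents R" "g \<noteq> \<zero>" "g \<noteq> \<one>"
    and x: "(e, u) \<in> verts (clean_graph2 R)" and y: "(f, v) \<in> verts (clean_graph2 R)"
  shows "graph_dist (clean_graph2 R) (e, u) (f, v) =
    (if (e, u) = (f, v) then 0
     else if e \<otimes> f = \<zero> \<or> u \<otimes> v = \<one> then 1
     else if e = \<one> \<and> f = \<one> then 3 else 2)"
proof -
  interpret sym_digraph "clean_graph2 R"
    by (rule clean_graph2_simple(3)) unfold_locales
  note arc = arcs_ends_clean_graph2 verts_clean_graph2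
  have e: "e \<in> idempotents R" "e \<in> carrier R" "e \<noteq> \<zero>" "u \<in> Units R"
    and f: "f \<in> idempotents R" "f \<in> carrier R" "f \<noteq> \<zero>" "v \<in> Units R"
    using x y by (auto simp: verts_clean_graph2 idempotents_def)
  have uv: "u \<in> carrier R" "v \<in> carrier R" "inv u \<in> carrier R" "inv v \<in> carrier R"
    "inv u \<in> Units R" "inv v \<in> Units R"
    using e f by (auto simp: Units_closed)
  have gc: "g \<in> carrier R"
    using g by (simp add: idempotents_def)
  note compl = idempotents_compl idempotents_compl_eq_zero_iff
  \<comment> \<open>The last two cases overlap if neither idempotent is 1; either complement then
    gives a common neighbour.\<close>
  consider "(e, u) = (f, v)"
    | "(e, u) \<noteq> (f, v)" "e \<otimes> f = \<zero> \<or> u \<otimes> v = \<one>"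
    | "(e, u) \<noteq> (f, v)" "e \<otimes> f \<noteq> \<zero>" "u \<otimes> v \<noteq> \<one>" "e = \<one>" "f = \<one>"
    | "(e, u) \<noteq> (f, v)" "e \<otimes> f \<noteq> \<zero>" "u \<otimes> v \<noteq> \<one>" "e \<noteq> \<one>"
    | "(e, u) \<noteq> (f, v)" "e \<otimes> f \<noteq> \<zero>" "u \<otimes> v \<noteq> \<one>" "f \<noteq> \<one>"
    by blast
  then show ?thesis
  proof cases
    case 1
    then show ?thesis
      using graph_dist_self x by simp
  next
    case 2
    then show ?thesis
      using graph_dist_adj x y by (auto simp: arcs_ends_clean_graph2)
  next
    case 3
    \<comment> \<open>Neighbours of \<open>(\<one>, u)\<close> and \<open>(\<one>, v)\<close> must
      carry the inverse units; the orthogonal idempotents \<open>g\<close> and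
      \<open>\<one> \<ominus> g\<close> make the two middle vertices adjacent.\<close>
    have "graph_dist (clean_graph2 R) (\<one>, u) (\<one>, v) = 3"
    proof (rule graph_dist_3[where z = "(g, inv u)" and w = "(\<one> \<ominus> g, inv v)"])
      show "(z, (\<one>, v)) \<notin> arcs_ends (clean_graph2 R)"
        if z: "((\<one>, u), z) \<in> arcs_ends (clean_graph2 R)" for z
      proof
        assume z': "(z, (\<one>, v)) \<in> arcs_ends (clean_graph2 R)"
        obtain h t where zt: "z = (h, t)"
          by (cases z)
        have t: "h \<in> carrier R" "h \<noteq> \<zero>" "t \<in> Units R"
          using z unfolding zt by (auto simp: arc idempotents_def)
        \<comment> \<open>Since \<open>h\<close> is nonzero, its products with 1 do not vanish; both
          adjacencies come from the units, and \<open>t\<close> is inverse to both \<open>u\<close>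
          and \<open>v\<close>.\<close>
        then have "u \<otimes> t = \<one>" "t \<otimes> v = \<one>"
          using z z' unfolding zt by (auto simp: arc)
        then have "u = v"
          using t(3) uv(1,2) by (metis Units_closed inv_unique)
        then show False
          using 3 by simp
      qed
      \<comment> \<open>Equality would turn \<open>g \<otimes> g = g\<close> into 0.\<close>
      have "g \<noteq> \<one> \<ominus> g"
        using g compl(2)[OF g(1)] by (auto simp: idempotents_def)
      then show "((g, inv u), (\<one> \<ominus> g, inv v)) \<in> arcs_ends (clean_graph2 R)"
        using g uv compl[OF g(1)] by (auto simp: arc)
      have "\<one> \<ominus> g \<noteq> \<one>"
        using g compl[OF g(1)] gc by auto
      then show "((\<one> \<ominus> g, inv v), (\<one>, v)) \<in> arcs_ends (clean_graph2 R)"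
        using g uv f 3 compl[OF g(1)] by (auto simp: arc Units_l_inv)
    qed (use g uv e f 3 in \<open>auto simp: arc\<close>)
    then show ?thesis
      using 3 by auto
  next
    case 4
    \<comment> \<open>The vertex \<open>(\<one> \<ominus> e, inv v)\<close> is adjacent to
      \<open>(e, u)\<close> by orthogonality and to \<open>(f, v)\<close> by inverse units; the two
      inequalities make it differ from both.\<close>
    have "f \<noteq> \<one> \<ominus> e"
      using 4 compl(2)[OF e(1)] by auto
    moreover have "e \<noteq> \<one> \<ominus> e"
      using e compl(2)[OF e(1)] by (auto simp: idempotents_def)
    ultimately have "graph_dist (clean_graph2 R) (e, u) (f, v) = 2"
      using 4 e f uv compl[OF e(1)]
      by (intro graph_dist_2[where z = "(\<one> \<ominus> e, inv v)"]) (auto simp: arc)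
    then show ?thesis
      using 4 by auto
  next
    case 5
    have "e \<noteq> \<one> \<ominus> f"
      using 5 compl(3)[OF f(1)] by auto
    moreover have "f \<noteq> \<one> \<ominus> f"
      using f compl(2)[OF f(1)] by (auto simp: idempotents_def)
    ultimately have "graph_dist (clean_graph2 R) (e, u) (f, v) = 2"
      using 5 e f uv compl[OF f(1)]
      by (intro graph_dist_2[where z = "(\<one> \<ominus> f, inv u)"]) (auto simp: arc)
    then show ?thesis
      using 5 by auto
  qed
qed

section \<open>Adjacent pairs of vertices\<close>

lemma Units_avoid_inverse_pair:
  assumes "infinite (Units R) \<or> card (Units R) \<ge> 2" "v \<in> Units R"
  obtains t where "t \<in> Units R" "t \<noteq> v" "t \<otimes> v \<noteq> \<one>"
proof -
  have "\<exists>t \<in> Units R. t \<noteq> v \<and> t \<otimes> v \<noteq> \<one>"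
  proof (rule ccontr)
    assume "\<not> ?thesis"
    then have *: "t = v \<or> t \<otimes> v = \<one>" if "t \<in> Units R" for t
      using that by blast
    \<comment> \<open>Otherwise the units are v and its inverse; one of them is 1, hence so are both.\<close>
    have "v = \<one>"
      using *[of \<one>] assms(2) Units_closed by auto
    then have "Units R \<subseteq> {\<one>}"
      using * Units_closed by fastforce
    then have "finite (Units R)" "card (Units R) \<le> 1"
      using card_mono[of "{\<one>}" "Units R"] finite_subset by auto
    then show False
      using assms(1) by auto
  qed
  then show ?thesis
    using that by blast
qed

text \<open>Adjacent vertices are at distance 1, while a vertex neither equal nor adjacent to
  \<open>(f, v)\<close> is at distance at least 2 from it; each case below need only exhibit such a
  neighbour \<open>(h, t)\<close> of \<open>(e, u)\<close>.\<close>

lemma not_maximally_distant_adj: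
  assumes g: "g \<in> idempotents R" "g \<noteq> \<zero>" "g \<noteq> \<one>"
    and "((e, u), (f, v)) \<in> arcs_ends (clean_graph2 R)"
    and "((e, u), (h, t)) \<in> arcs_ends (clean_graph2 R)"
    and "(f, v) \<noteq> (h, t)" "f \<otimes> h \<noteq> \<zero>" "v \<otimes> t \<noteq> \<one>"
  shows "\<not> maximally_distant (clean_graph2 R) (e, u) (f, v)"
proof
  assume "maximally_distant (clean_graph2 R) (e, u) (f, v)"
  then have "graph_dist (clean_graph2 R) (f, v) (h, t) \<le> graph_dist (clean_graph2 R) (e, u) (f, v)"
    using assms(5) by (auto simp: maximally_distant_def neighbourhood_def)
  moreover have v: "(e, u) \<in> verts (clean_graph2 R)" "(f, v) \<in> verts (clean_graph2 R)"
    "(h, t) \<in> verts (clean_graph2 R)" "(e, u) \<noteq> (f, v)" "e \<otimes> f = \<zero> \<or> u \<otimes> v = \<one>"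
    using assms(4,5) unfolding arcs_ends_clean_graph2 by blast+
  ultimately show False
    using assms(6-8) by (auto simp: clean_graph2_dist[OF g] one_ereal_def split: if_splits)
qed

lemma not_mutually_maximally_distant_adj:
  assumes g: "g \<in> idempotents R" "g \<noteq> \<zero>" "g \<noteq> \<one>"
    and U: "infinite (Units R) \<or> card (Units R) \<ge> 2"
    and adj: "((e, u), (f, v)) \<in> arcs_ends (clean_graph2 R)"
  shows "\<not> mutually_maximally_distant (clean_graph2 R) (e, u) (f, v)"
proof -
  note arc = arcs_ends_clean_graph2 verts_clean_graph2
  have e: "e \<in> idempotents R" "e \<in> carrier R" "e \<otimes> e = e" "e \<noteq> \<zero>" "u \<in> Units R" "u \<in> carrier R"
    and f: "f \<in> idempotents R" "f \<in> carrier R" "f \<otimes> f = f" "f \<noteq> \<zero>" "v \<in> Units R" "v \<in> carrier R"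
    and ne: "(e, u) \<noteq> (f, v)" and or: "e \<otimes> f = \<zero> \<or> u \<otimes> v = \<one>"
    using adj by (auto simp: arc idempotents_def Units_closed)
  have gc: "g \<in> carrier R"
    using g by (simp add: idempotents_def)
  have one: "\<one> \<in> idempotents R" "\<one> \<noteq> \<zero>"
    using g gc by (auto simp: idempotents_def dest: one_zeroD)
  note nmd = not_maximally_distant_adj[OF g]
  consider "u \<otimes> v = \<one>" "u \<noteq> v" | "u \<otimes> v = \<one>" "u = v" "e \<noteq> f" | "u \<otimes> v \<noteq> \<one>" "e \<otimes> f = \<zero>"
    using ne or by blast
  then show ?thesis
  proof cases
    case 1
    then have vv: "v \<otimes> v \<noteq> \<one>"
      using e f by (metis inv_unique)
    \<comment> \<open>The witness \<open>(h, v)\<close> is adjacent to \<open>(e, u)\<close> through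
      their inverse units, so its idempotent is free: \<open>h\<close> must differ from
      \<open>f\<close> without being orthogonal to it.\<close>
    define h where "h = (if f = \<one> then g else \<one>)"
    have "h \<in> idempotents R" "h \<noteq> \<zero>" "h \<noteq> f" "f \<otimes> h \<noteq> \<zero>"
      using g gc one f by (auto simp: h_def)
    then have "\<not> maximally_distant (clean_graph2 R) (e, u) (f, v)"
      using 1 vv e f by (intro nmd[OF adj, of h v]) (auto simp: arc)
    then show ?thesis
      by (simp add: mutually_maximally_distant_def)
  next
    case 2
    \<comment> \<open>The witness is \<open>(\<one> \<ominus> e', t)\<close> with \<open>t\<close>
      neither \<open>u\<close> nor its inverse, adjacent to \<open>(e', u)\<close> by orthogonality.
      It requires that \<open>f'\<close> not lie below \<open>e'\<close> in the order of
      idempotents.\<close>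
    have nmd': "\<not> maximally_distant (clean_graph2 R) (e', u) (f', u)"
      if adj': "((e', u), (f', u)) \<in> arcs_ends (clean_graph2 R)"
        and "f' \<otimes> (\<one> \<ominus> e') \<noteq> \<zero>" for e' f'
    proof -
      have e': "e' \<in> idempotents R" "e' \<in> carrier R" "e' \<noteq> \<zero>" "e' \<otimes> e' = e'" "f' \<in> carrier R"
        using adj' by (auto simp: arc idempotents_def)
      obtain t where t: "t \<in> Units R" "t \<noteq> u" "t \<otimes> u \<noteq> \<one>"
        using Units_avoid_inverse_pair[OF U e(5)] .
      have "e' \<noteq> \<one> \<ominus> e'"
        using e' idempotents_compl(2)[OF e'(1)] by auto
      moreover have "\<one> \<ominus> e' \<noteq> \<zero>"
        using that(2) e'(5) by auto
      ultimately show ?thesis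
        using idempotents_compl[OF e'(1)] e' e t that(2)
        by (intro nmd[OF adj', of "\<one> \<ominus> e'" t]) (auto simp: arc m_comm Units_closed)
    qed
    \<comment> \<open>The order \<open>x \<otimes> y = x\<close> on idempotents is antisymmetric, so
      distinct \<open>e\<close> and \<open>f\<close> cannot each lie below the other; one of the two
      directions has a witness.\<close>
    have "f \<otimes> (\<one> \<ominus> e) \<noteq> \<zero> \<or> e \<otimes> (\<one> \<ominus> f) \<noteq> \<zero>"
    proof (rule ccontr)
      assume "\<not> ?thesis"
      moreover have "f \<otimes> (\<one> \<ominus> e) = f \<ominus> e \<otimes> f" "e \<otimes> (\<one> \<ominus> f) = e \<ominus> e \<otimes> f"
        using e(2) f(2) by algebra+
      ultimately have "f = e \<otimes> f" "e = e \<otimes> f"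
        using e(2) f(2) by (metis m_closed minus_eq_zero_iff)+
      then show False
        using 2 by simp
    qed
    then show ?thesis
      using nmd'[of e f] nmd'[of f e] adj arcs_ends_clean_graph2_sym[OF adj] 2(2)
      unfolding mutually_maximally_distant_def by auto
  next
    case 3
    \<comment> \<open>Keeping \<open>f\<close> retains orthogonality to \<open>e\<close>, while
      \<open>f \<otimes> f = f\<close> is nonzero; the fresh unit makes \<open>(f, t)\<close>
      neither equal nor adjacent to \<open>(f, v)\<close>.\<close>
    obtain t where t: "t \<in> Units R" "t \<noteq> v" "t \<otimes> v \<noteq> \<one>"
      using Units_avoid_inverse_pair[OF U f(5)] .
    have "e \<noteq> f"
      using 3 e by auto
    then have "\<not> maximally_distant (clean_graph2 R) (e, u) (f, v)"
      using 3 t e f by (intro nmd[OF adj, of f t]) (auto simp: arc m_comm Units_closed)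
    then show ?thesis
      by (simp add: mutually_maximally_distant_def)
  qed
qed

section \<open>Non-adjacent pairs of vertices\<close>

text \<open>If \<open>f\<close> is 1, so is \<open>e\<close>, and the distance is already the
  overall maximum 3. Otherwise it is at least 2, and no vertex is farther than 2 from
  \<open>(f, v)\<close>.\<close>

lemma maximally_distant_nonadj:
  assumes g: "g \<in> idempotents R" "g \<noteq> \<zero>" "g \<noteq> \<one>"
    and x: "(e, u) \<in> verts (clean_graph2 R)" and y: "(f, v) \<in> verts (clean_graph2 R)"
    and nonadj: "(e, u) \<noteq> (f, v)" "e \<otimes> f \<noteq> \<zero>" "u \<otimes> v \<noteq> \<one>"
    and f: "f = \<one> \<Longrightarrow> e = \<one>"
  shows "maximally_distant (clean_graph2 R) (e, u) (f, v)"
  unfolding maximally_distant_def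
proof
  fix w assume "w \<in> neighbourhood (clean_graph2 R) (e, u)"
  then obtain h t where "w = (h, t)" "(h, t) \<in> verts (clean_graph2 R)"
    by (cases w) (auto simp: neighbourhood_def arcs_ends_clean_graph2)
  then show "graph_dist (clean_graph2 R) (f, v) w \<le> graph_dist (clean_graph2 R) (e, u) (f, v)"
    using x y nonadj f by (auto simp: clean_graph2_dist[OF g])
qed

text \<open>Only vertices with idempotent 1 can be at distance 3 from \<open>(\<one>, u)\<close>,
  and the only such neighbour of \<open>(f, v)\<close> is \<open>(\<one>, inv v)\<close>. As it
  differs from \<open>(\<one>, u)\<close>, it is within distance 2 exactly when it is adjacent, that
  is, when \<open>u = v\<close>.\<close>

lemma maximally_distant_one_iff:
  assumes g: "g \<in> idempotents R" "g \<noteq> \<zero>" "g \<noteq> \<one>"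
    and x: "(f, v) \<in> verts (clean_graph2 R)" and y: "(\<one>, u) \<in> verts (clean_graph2 R)"
    and nonadj: "f \<noteq> \<one>" "u \<otimes> v \<noteq> \<one>"
  shows "maximally_distant (clean_graph2 R) (f, v) (\<one>, u) \<longleftrightarrow> u = v"
proof -
  have f: "f \<in> carrier R" "f \<noteq> \<zero>" "v \<in> Units R" "v \<in> carrier R" "u \<in> Units R" "u \<in> carrier R"
    using x y by (auto simp: verts_clean_graph2 idempotents_def Units_closed)
  have dist: "graph_dist (clean_graph2 R) (f, v) (\<one>, u) = 2"
    using x y nonadj f by (auto simp: clean_graph2_dist[OF g] m_comm)
  show ?thesis
  proof
    assume md: "maximally_distant (clean_graph2 R) (f, v) (\<one>, u)"
    have w: "(\<one>, inv v) \<in> verts (clean_graph2 R)"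
      using y f by (simp add: verts_clean_graph2)
    then have "(\<one>, inv v) \<in> neighbourhood (clean_graph2 R) (f, v)"
      using x nonadj f by (simp add: neighbourhood_def arcs_ends_clean_graph2)
    then have le: "graph_dist (clean_graph2 R) (\<one>, u) (\<one>, inv v) \<le> 2"
      using md dist by (auto simp: maximally_distant_def)
    have "u \<noteq> inv v"
      using nonadj(2) f by auto
    moreover have "\<one> \<noteq> \<zero>"
      using y by (simp add: verts_clean_graph2)
    ultimately have "u \<otimes> inv v = \<one>"
      using le by (simp add: clean_graph2_dist[OF g y w] split: if_splits)
    then show "u = v"
      using f by (metis Units_inv_closed Units_l_inv inv_unique)
  next
    assume [simp]: "u = v"
    show "maximally_distant (clean_graph2 R) (f, v) (\<one>, u)"
      unfolding maximally_distant_def dist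
    proof
      fix w assume "w \<in> neighbourhood (clean_graph2 R) (f, v)"
      then obtain h t where w: "w = (h, t)" "(h, t) \<in> verts (clean_graph2 R)"
        "f \<otimes> h = \<zero> \<or> v \<otimes> t = \<one>"
        by (cases w) (auto simp: neighbourhood_def arcs_ends_clean_graph2)
      then show "graph_dist (clean_graph2 R) (\<one>, u) w \<le> 2"
        using y f by (auto simp: clean_graph2_dist[OF g] one_ereal_def)
    qed
  qed
qed

end

section \<open>Completeness for a single unit, and the classification otherwise\<close>

theorem theorem3p2:
  fixes R :: "('a, 'm) ring_scheme" (structure)
  assumes "cring R"
    and "\<exists>e \<in> idempotents R. e \<noteq> \<zero> \<and> e \<noteq> \<one>"
  shows "(card (Units R) = 1 \<longrightarrow> complete_graph (clean_graph2 R)) \<and>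
    (infinite (Units R) \<or> card (Units R) \<ge> 2 \<longrightarrow>
      (\<forall>e u f v. (e, u) \<in> verts (clean_graph2 R) \<longrightarrow> (f, v) \<in> verts (clean_graph2 R) \<longrightarrow>
        (e, u) \<noteq> (f, v) \<longrightarrow>
        (mutually_maximally_distant (clean_graph2 R) (e, u) (f, v) \<longleftrightarrow>
          (e = \<one> \<and> f = \<one> \<and> u \<otimes> v \<noteq> \<one>) \<or>
          (e \<noteq> \<one> \<and> f \<noteq> \<one> \<and> e \<otimes> f \<noteq> \<zero> \<and> u \<otimes> v \<noteq> \<one>) \<or>
          ((e = \<one> \<and> f \<noteq> \<one> \<or> e \<noteq> \<one> \<and> f = \<one>) \<and> u = v \<and> u \<in> Units_noninvol R))))"
proof -
  interpret cring R by fact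
  obtain g where g: "g \<in> idempotents R" "g \<noteq> \<zero>" "g \<noteq> \<one>"
    using assms(2) by blast
  have complete: "complete_graph (clean_graph2 R)" if "card (Units R) = 1"
  proof -
    \<comment> \<open>With a single unit every product of units is 1, so any two distinct vertices
      are adjacent.\<close>
    have "Units R = {\<one>}"
      using that Units_one_closed by (metis card_1_singletonE singletonD)
    then show ?thesis
      by (auto simp: complete_graph_def arcs_ends_clean_graph2 verts_clean_graph2)
  qed
  \<comment> \<open>As \<open>card\<close> is 0 on infinite sets, \<open>U\<close> lists the
    infinite case separately to express that there are at least two units.\<close>
  have mmd: "mutually_maximally_distant (clean_graph2 R) (e, u) (f, v) \<longleftrightarrow>
      (e = \<one> \<and> f = \<one> \<and> u \<otimes> v \<noteq> \<one>) \<or>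
      (e \<noteq> \<one> \<and> f \<noteq> \<one> \<and> e \<otimes> f \<noteq> \<zero> \<and> u \<otimes> v \<noteq> \<one>) \<or>
      ((e = \<one> \<and> f \<noteq> \<one> \<or> e \<noteq> \<one> \<and> f = \<one>) \<and> u = v \<and> u \<in> Units_noninvol R)" (is "_ \<longleftrightarrow> ?R")
    if U: "infinite (Units R) \<or> card (Units R) \<ge> 2"
      and x: "(e, u) \<in> verts (clean_graph2 R)" and y: "(f, v) \<in> verts (clean_graph2 R)"
      and ne: "(e, u) \<noteq> (f, v)" for e u f v
  proof -
    have c: "e \<in> carrier R" "e \<noteq> \<zero>" "f \<in> carrier R" "f \<noteq> \<zero>"
      "u \<in> Units R" "u \<in> carrier R" "v \<in> carrier R"
      using x y by (auto simp: verts_clean_graph2 idempotents_def Units_closed)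
    have noninvol: "u \<in> Units_noninvol R \<longleftrightarrow> u \<otimes> u \<noteq> \<one>"
      using c by (simp add: Units_noninvol_def Units_invol_def)
    show ?thesis
    proof (cases "e \<otimes> f = \<zero> \<or> u \<otimes> v = \<one>")
      case True
      then have "\<not> mutually_maximally_distant (clean_graph2 R) (e, u) (f, v)"
        using not_mutually_maximally_distant_adj[OF g U] x y ne by (simp add: arcs_ends_clean_graph2)
      \<comment> \<open>If \<open>e\<close> or \<open>f\<close> is 1, their product is nonzero, so
        adjacency forces \<open>u \<otimes> v = \<one>\<close>; with \<open>u = v\<close> the unit
        is then an involution.\<close>
      moreover have "\<not> ?R"
        using True c noninvol by auto
      ultimately show ?thesis
        by blast
    next
      case False
      then have na: "e \<otimes> f \<noteq> \<zero>" "u \<otimes> v \<noteq> \<one>" "f \<otimes> e \<noteq> \<zero>" "v \<otimes> u \<noteq> \<one>"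
        using c by (auto simp: m_comm)
      note md = maximally_distant_nonadj[OF g x y ne na(1,2)]
        maximally_distant_nonadj[OF g y x ne[symmetric] na(3,4)]
      \<comment> \<open>If exactly one idempotent is 1, one direction is automatic and the other
        amounts to \<open>u = v\<close>, which together with
        \<open>u \<otimes> v \<noteq> \<one>\<close> gives condition (c). Otherwise both directions
        hold.\<close>
      consider "e = \<one> \<longleftrightarrow> f = \<one>" | "e = \<one>" "f \<noteq> \<one>" | "e \<noteq> \<one>" "f = \<one>"
        by blast
      then show ?thesis
      proof cases
        case 1
        then show ?thesis
          using md na by (auto simp: mutually_maximally_distant_def)
      next
        case 2
        then show ?thesis
          using md(1) maximally_distant_one_iff[OF g y] x na noninvol
          by (auto simp: mutually_maximally_distant_def)
      next
        case 3
        then show ?thesis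
          using md(2) maximally_distant_one_iff[OF g x] y na noninvol
          by (auto simp: mutually_maximally_distant_def)
      qed
    qed
  qed
  show ?thesis
    using complete mmd by blast
qed

end
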